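(* Let $N\ge d\ge 1$ be integers. The number of elements of $A_N$ is equal to the number of elements of $B_N$, where $A_N$ is the set of integer partitions of $N$ in which at least one part is divisible by $d$, and $B_N$ is the set of integer partitions of $N$ in which at least one part is repeated $d$ or more times. Equivalently, passing to complements in the set of all integer partitions of $N$, the number of integer partitions of $N$ all of whose parts fail to be divisible by $d$ is equal to the number of integer partitions of $N$ where no part is repeated $d$ or more times.
   Context: An integer partition of a positive integer $N$ is a multiset of positive integers (its parts) whose sum is $N$. A part is repeated $d$ or more times if it occurs at least $d$ times in the partition. The second formulation is Glaisher's theorem. *)

theory Defs
  imports Main "HOL-Library.Multiset"
begin

definition partitions :: "nat \<Rightarrow> nat multiset set" where
  "partitions N = {p. (\<forall>x\<in>#p. 0 < x) \<and> sum_mset p = N}"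

definition partitions_some_divisible :: "nat \<Rightarrow> nat \<Rightarrow> nat multiset set" where
  "partitions_some_divisible d N = {p \<in> partitions N. \<exists>x\<in>#p. d dvd x}"

definition partitions_some_repeated :: "nat \<Rightarrow> nat \<Rightarrow> nat multiset set" where
  "partitions_some_repeated d N = {p \<in> partitions N. \<exists>x\<in>#p. d \<le> count p x}"

definition partitions_none_divisible :: "nat \<Rightarrow> nat \<Rightarrow> nat multiset set" where
  "partitions_none_divisible d N = {p \<in> partitions N. \<forall>x\<in>#p. \<not> d dvd x}"

definition partitions_none_repeated :: "nat \<Rightarrow> nat \<Rightarrow> nat multiset set" where
  "partitions_none_repeated d N = {p \<in> partitions N. \<not> (\<exists>x\<in>#p. d \<le> count p x)}"

(* card of an infinite set is 0, so equal cardinalities mean equinumerosity only because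
   of this finiteness. *)
lemma finite_partitions: "finite (partitions N)"
proof -
  have size_le: "size p \<le> sum_mset p" if "\<forall>x\<in>#p. 0 < x" for p :: "nat multiset"
    using that by (induction p) auto
  have "partitions N \<subseteq> mset ` {xs. set xs \<subseteq> {..N} \<and> length xs \<le> N}"
  proof
    fix p assume p: "p \<in> partitions N"
    obtain xs where xs: "mset xs = p" using ex_mset by blast
    have "length xs \<le> N"
      using p size_le[of p] xs unfolding partitions_def by auto
    moreover have "set xs \<subseteq> {..N}"
    proof
      fix x assume "x \<in> set xs"
      then have "x \<in># p" using xs by auto
      then obtain q where "p = add_mset x q" by (meson mset_add)
      then show "x \<in> {..N}" using p unfolding partitions_def by auto
    qed
    ultimately show "p \<in> mset ` {xs. set xs \<subseteq> {..N} \<and> length xs \<le> N}"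
      using xs by blast
  qed
  then show ?thesis
    by (rule finite_subset) (simp add: finite_lists_length_le)
qed

end

theory Submission
  imports Defs
begin

text \<open>
  The proof is inclusion-exclusion. Up to passing to complements, one counts the partitions of
  \<open>N\<close> that avoid, for every \<open>i \<in> {1..N}\<close>, the property ``\<open>d * i\<close> is a part'', respectively
  ``\<open>i\<close> occurs at least \<open>d\<close> times''. By inclusion-exclusion
  (\<open>card_avoid_all_eq\<close>) it suffices to fix a set \<open>J\<close> of indices and to count the partitions
  that have the property for all \<open>i \<in> J\<close>. These are the partitions that contain a fixed
  multiset \<open>M\<close> of parts: \<open>M\<close> is the set of all \<open>d * i\<close> with \<open>i \<in> J\<close> in the first case, and
  \<open>d\<close> copies of each \<open>i \<in> J\<close> in the second. Removing \<open>M\<close> shows that the count depends only on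
  the sum of \<open>M\<close> (\<open>card_partitions_containing\<close>), and both multisets sum to \<open>d * \<Sum>J\<close>.
\<close>

text \<open>
  Inclusion-exclusion without the alternating sum. Elements of \<open>U\<close> that avoid \<open>P i\<close> and all
  \<open>P j\<close> with \<open>j \<in> I\<close> are those of \<open>U\<close> that avoid all \<open>P j\<close>, less those of \<open>{x \<in> U. P i x}\<close>
  that do so; the induction therefore has to vary the ground sets \<open>U\<close> and \<open>V\<close>.
\<close>

lemma card_avoid_all_eq:
  assumes "finite I" and "finite U" and "finite V"
    and "\<And>J. J \<subseteq> I \<Longrightarrow> card {x\<in>U. \<forall>i\<in>J. P i x} = card {y\<in>V. \<forall>i\<in>J. Q i y}"
  shows "card {x\<in>U. \<forall>i\<in>I. \<not> P i x} = card {y\<in>V. \<forall>i\<in>I. \<not> Q i y}"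
  using assms
proof (induction I arbitrary: U V rule: finite_induct)
  case empty
  then show ?case using empty(3)[of "{}"] by simp
next
  case (insert i I)
  have split: "card {x\<in>W. \<forall>j\<in>insert i I. \<not> R j x}
      = card {x\<in>W. \<forall>j\<in>I. \<not> R j x} - card {x\<in>{x\<in>W. R i x}. \<forall>j\<in>I. \<not> R j x}"
    if "finite W" for W :: "'z set" and R
  proof -
    have "{x\<in>W. \<forall>j\<in>insert i I. \<not> R j x}
        = {x\<in>W. \<forall>j\<in>I. \<not> R j x} - {x\<in>{x\<in>W. R i x}. \<forall>j\<in>I. \<not> R j x}"
      by auto
    then show ?thesis
      using that by (simp only:) (rule card_Diff_subset, auto)
  qed
  have all: "card {x\<in>U. \<forall>j\<in>I. \<not> P j x} = card {y\<in>V. \<forall>j\<in>I. \<not> Q j y}"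
    using insert.prems by (intro insert.IH) auto
  have at_i: "card {x\<in>{x\<in>U. P i x}. \<forall>j\<in>I. \<not> P j x}
      = card {y\<in>{y\<in>V. Q i y}. \<forall>j\<in>I. \<not> Q j y}"
  proof (rule insert.IH)
    fix J assume "J \<subseteq> I"
    then show "card {x\<in>{x\<in>U. P i x}. \<forall>j\<in>J. P j x} = card {y\<in>{y\<in>V. Q i y}. \<forall>j\<in>J. Q j y}"
      using insert.prems(3)[of "insert i J"] by (simp add: conj_assoc subset_insertI2)
  qed (use insert.prems in auto)
  show ?case
    using split[of U P] split[of V Q] insert.prems all at_i by simp
qed

lemma card_partitions_containing:
  assumes "\<forall>x\<in>#M. 0 < x"
  shows "card {p \<in> partitions N. M \<subseteq># p}
    = (if sum_mset M \<le> N then card (partitions (N - sum_mset M)) else 0)"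
proof (cases "sum_mset M \<le> N")
  case True
  have "bij_betw (\<lambda>q. q + M) (partitions (N - sum_mset M)) {p \<in> partitions N. M \<subseteq># p}"
    by (rule bij_betw_byWitness[where f' = "\<lambda>p. p - M"])
      (use True assms in \<open>auto simp: partitions_def sum_mset_diff dest: in_diffD\<close>)
  with True show ?thesis
    by (simp add: bij_betw_same_card)
next
  case False
  then have "{p \<in> partitions N. M \<subseteq># p} = {}"
    by (auto simp: partitions_def subset_mset.le_iff_add)
  with False show ?thesis by (simp only: card.empty if_False)
qed

lemma partition_part_le: "p \<in> partitions N \<Longrightarrow> x \<in># p \<Longrightarrow> x \<le> N"
  by (auto simp: partitions_def dest!: multi_member_split)

lemma contains_mset_set_iff:
  "finite S \<Longrightarrow> mset_set S \<subseteq># p \<longleftrightarrow> (\<forall>x\<in>S. x \<in># p)"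
  by (auto simp: subseteq_mset_def count_mset_set' Suc_le_eq)

lemma contains_repeat_mset_set_iff:
  "finite S \<Longrightarrow> repeat_mset d (mset_set S) \<subseteq># p \<longleftrightarrow> (\<forall>x\<in>S. d \<le> count p x)"
  by (auto simp: subseteq_mset_def count_mset_set')

lemma card_contains_multiples_eq_card_contains_repeats:
  fixes d :: nat
  assumes d: "0 < d" and J: "finite J" "0 \<notin> J"
  shows "card {p \<in> partitions N. \<forall>i\<in>J. d * i \<in># p}
    = card {p \<in> partitions N. \<forall>i\<in>J. d \<le> count p i}"
proof -
  let ?M = "mset_set ((*) d ` J)" and ?M' = "repeat_mset d (mset_set J)"
  have "sum_mset ?M = d * sum_mset (mset_set J)"
    using d by (subst image_mset_mset_set[symmetric]) (auto simp: inj_on_def sum_mset_distrib_left[where f = "\<lambda>i. i", simplified])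
  also have "\<dots> = sum_mset ?M'"
    by (induction d) simp_all
  finally have "sum_mset ?M = sum_mset ?M'" .
  moreover have "\<forall>x\<in>#?M. 0 < x"
    using d J by (auto intro: gr0I)
  moreover have "\<forall>x\<in>#?M'. 0 < x"
  proof
    fix x assume "x \<in># ?M'"
    then have "x \<in> J"
      by (auto simp flip: count_greater_zero_iff simp: count_mset_set' split: if_splits)
    with J show "0 < x" by (auto intro: gr0I)
  qed
  ultimately have "card {p \<in> partitions N. ?M \<subseteq># p} = card {p \<in> partitions N. ?M' \<subseteq># p}"
    by (simp only: card_partitions_containing)
  then show ?thesis
    using J by (simp add: contains_mset_set_iff contains_repeat_mset_set_iff)
qed

text \<open>
  Both families of forbidden properties are indexed by \<open>{1..N}\<close>: this loses nothing, as a part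
  \<open>d * i\<close> of a partition of \<open>N\<close> has \<open>1 \<le> i \<le> N\<close>, and so has a part \<open>i\<close>.
\<close>

lemma partitions_none_divisible_altdef:
  assumes "0 < d"
  shows "partitions_none_divisible d N = {p \<in> partitions N. \<forall>i\<in>{1..N}. d * i \<notin># p}"
proof -
  have "k \<in> {1..N}" if "p \<in> partitions N" "d * k \<in># p" for p k
  proof -
    have "0 < d * k" using that by (auto simp: partitions_def)
    moreover have "k \<le> N"
    proof (rule le_trans)
      show "k \<le> d * k" using assms by simp
      show "d * k \<le> N" using that by (rule partition_part_le)
    qed
    ultimately show ?thesis by simp
  qed
  then have "(\<forall>x\<in>#p. \<not> d dvd x) \<longleftrightarrow> (\<forall>i\<in>{1..N}. d * i \<notin># p)" if "p \<in> partitions N" for p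
    using that unfolding dvd_def by blast
  then show ?thesis
    unfolding partitions_none_divisible_def by blast
qed

lemma partitions_none_repeated_altdef:
  assumes "0 < d"
  shows "partitions_none_repeated d N = {p \<in> partitions N. \<forall>i\<in>{1..N}. \<not> d \<le> count p i}"
proof -
  have "i \<in># p" if "d \<le> count p i" for p and i :: nat
    using assms that by (simp flip: count_greater_zero_iff)
  moreover have "i \<in> {1..N}" if "p \<in> partitions N" "i \<in># p" for p i
    using that partition_part_le[OF that] by (auto simp: partitions_def Suc_le_eq)
  ultimately show ?thesis
    unfolding partitions_none_repeated_def by blast
qed

lemma card_partitions_none_divisible_eq_none_repeated:
  assumes "0 < d"
  shows "card (partitions_none_divisible d N) = card (partitions_none_repeated d N)"
  unfolding partitions_none_divisible_altdef[OF assms] partitions_none_repeated_altdef[OF assms]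
proof (rule card_avoid_all_eq)
  fix J assume "J \<subseteq> {1..N}"
  then have "finite J" "0 \<notin> J" by (auto intro: finite_subset)
  then show "card {p \<in> partitions N. \<forall>i\<in>J. d * i \<in># p}
      = card {p \<in> partitions N. \<forall>i\<in>J. d \<le> count p i}"
    by (rule card_contains_multiples_eq_card_contains_repeats[OF assms])
qed (simp_all add: finite_partitions)

theorem mainTheorem1:
  fixes N d :: nat
  assumes "1 \<le> d" and "d \<le> N"
  shows "card (partitions_some_divisible d N) = card (partitions_some_repeated d N)
    \<and> card (partitions_none_divisible d N) = card (partitions_none_repeated d N)"
proof -
  have none: "card (partitions_none_divisible d N) = card (partitions_none_repeated d N)"
    using assms by (intro card_partitions_none_divisible_eq_none_repeated) simp
  have "partitions_some_divisible d N = partitions N - partitions_none_divisible d N"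
    "partitions_some_repeated d N = partitions N - partitions_none_repeated d N"
    by (auto simp: partitions_some_divisible_def partitions_none_divisible_def
        partitions_some_repeated_def partitions_none_repeated_def)
  moreover have "partitions_none_divisible d N \<subseteq> partitions N"
    "partitions_none_repeated d N \<subseteq> partitions N"
    by (auto simp: partitions_none_divisible_def partitions_none_repeated_def)
  ultimately have "card (partitions_some_divisible d N) = card (partitions_some_repeated d N)"
    using none by (simp add: card_Diff_subset finite_subset[OF _ finite_partitions])
  with none show ?thesis by blast
qed

end
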